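(* Fix $\mu_1,\mu_2\ge 0$, and consider the optimal policy, i.e. the optimal solution $(r_{1n},r_{2n})_{n=1}^N$ of $$\max\ \mu_1\sum_{n=1}^N r_{1n}l_n+\mu_2\sum_{n=1}^N r_{2n}l_n\quad\text{s.t.}\quad \sum_{n=1}^j g(r_{1n},r_{2n})l_n\le\sum_{n=0}^{j-1}E_n,\quad 0<j\le N,$$ over nonnegative rates, with total power $P_n=g(r_{1n},r_{2n})$ in the $n$-th interval. Under the optimal policy there exists a constant cut-off power level for user 1, $$P_c=\left(\frac{\mu_1(\sigma^2-1)}{\mu_2-\mu_1}-1\right)^+,$$ with the following property. If the total power level $P_n$ is below $P_c$, then all the power is allocated to user 1. If the total power level $P_n$ is higher than $P_c$, then all the power above the level $P_c$ is allocated to user 2.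
   Context: A transmitter harvests energy $E_k$ at time $s_k$, $k=0,\dots,N-1$, where $0=s_0<s_1<\dots<s_{N-1}<s_N=T$, $T$ is a given deadline, and $l_n=s_n-s_{n-1}$. It serves two users over an AWGN broadcast channel with noise variances $1$ (user 1, the stronger user) and $\sigma^2>1$ (user 2, the weaker user). The rates $(r_{1n},r_{2n})$ are used on $[s_{n-1},s_n)$. If total power $P$ is split as $p_1$ to user 1 and $P-p_1$ to user 2, the rates are $r_1=\frac12\log_2(1+p_1)$ and $r_2=\frac12\log_2\left(1+\frac{P-p_1}{p_1+\sigma^2}\right)$; equivalently $P=g(r_1,r_2):=2^{2(r_1+r_2)}+(\sigma^2-1)2^{2r_2}-\sigma^2$ and $p_1=2^{2r_1}-1$. Notation: $(x)^+=\max\{x,0\}$.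
   Formalization: The formula for P_c is used only when μ1<μ2; for μ1≥μ2 the cut-off is taken as +∞ (all power to user 1), since the literal formula gives 0 (a false claim) for μ1>μ2 and is undefined for μ1=μ2. The case μ1=μ2=0, where P_c is 0/0, is excluded. *)

theory Defs
  imports Complex_Main "HOL-Library.Extended_Real"
begin

definition rate1 :: "real \<Rightarrow> real" where
  "rate1 p1 = 1 / 2 * log 2 (1 + p1)"

definition rate2 :: "real \<Rightarrow> real \<Rightarrow> real \<Rightarrow> real" where
  "rate2 \<sigma> P p1 = 1 / 2 * log 2 (1 + (P - p1) / (p1 + \<sigma>\<^sup>2))"

definition total_power :: "real \<Rightarrow> real \<Rightarrow> real \<Rightarrow> real" where
  "total_power \<sigma> r1 r2 = 2 powr (2 * (r1 + r2)) + (\<sigma>\<^sup>2 - 1) * 2 powr (2 * r2) - \<sigma>\<^sup>2"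

definition user1_power :: "real \<Rightarrow> real" where
  "user1_power r1 = 2 powr (2 * r1) - 1"

definition user2_power :: "real \<Rightarrow> real \<Rightarrow> real \<Rightarrow> real" where
  "user2_power \<sigma> r1 r2 = total_power \<sigma> r1 r2 - user1_power r1"

text \<open>A power split \<open>(p1, P - p1)\<close> and its rate pair determine each other.\<close>

lemma powers_of_rates:
  assumes "\<sigma>\<^sup>2 > 1" "0 \<le> p1" "p1 \<le> P"
  shows "user1_power (rate1 p1) = p1"
    and "total_power \<sigma> (rate1 p1) (rate2 \<sigma> P p1) = P"
    and "user2_power \<sigma> (rate1 p1) (rate2 \<sigma> P p1) = P - p1"
proof -
  have pos: "p1 + \<sigma>\<^sup>2 > 0" using assms by simp
  have 1: "2 powr (2 * rate1 p1) = 1 + p1"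
    using assms by (simp add: rate1_def)
  have "1 + (P - p1) / (p1 + \<sigma>\<^sup>2) > 0"
    using assms pos by (simp add: add_pos_nonneg)
  then have 2: "2 powr (2 * rate2 \<sigma> P p1) = 1 + (P - p1) / (p1 + \<sigma>\<^sup>2)"
    by (simp add: rate2_def)
  have 3: "(p1 + \<sigma>\<^sup>2) * (1 + (P - p1) / (p1 + \<sigma>\<^sup>2)) = P + \<sigma>\<^sup>2"
    using pos by (simp add: field_simps)
  show p1: "user1_power (rate1 p1) = p1" by (simp add: user1_power_def 1)
  have "total_power \<sigma> (rate1 p1) (rate2 \<sigma> P p1)
      = (2 powr (2 * rate1 p1) - 1 + \<sigma>\<^sup>2) * 2 powr (2 * rate2 \<sigma> P p1) - \<sigma>\<^sup>2"
    by (simp only: total_power_def distrib_left powr_add) (simp add: algebra_simps)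
  also have "\<dots> = (p1 + \<sigma>\<^sup>2) * (1 + (P - p1) / (p1 + \<sigma>\<^sup>2)) - \<sigma>\<^sup>2"
    by (simp only: 1 2) simp
  finally show t: "total_power \<sigma> (rate1 p1) (rate2 \<sigma> P p1) = P" using 3 by simp
  show "user2_power \<sigma> (rate1 p1) (rate2 \<sigma> P p1) = P - p1" by (simp add: user2_power_def t p1)
qed

lemma rates_of_powers:
  assumes "\<sigma>\<^sup>2 > 1"
  shows "rate1 (user1_power r1) = r1"
    and "rate2 \<sigma> (total_power \<sigma> r1 r2) (user1_power r1) = r2"
proof -
  show "rate1 (user1_power r1) = r1" by (simp add: rate1_def user1_power_def)
  define a where "a = 2 powr (2 * r1)"
  define b where "b = 2 powr (2 * r2)"
  have "a > 0" by (simp add: a_def)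
  then have pos: "a - 1 + \<sigma>\<^sup>2 > 0" using assms by linarith
  have tp: "total_power \<sigma> r1 r2 = (a - 1 + \<sigma>\<^sup>2) * b - \<sigma>\<^sup>2"
    by (simp only: total_power_def distrib_left powr_add a_def b_def) (simp add: algebra_simps)
  have "1 + (total_power \<sigma> r1 r2 - (a - 1)) / (a - 1 + \<sigma>\<^sup>2) = b"
    using pos unfolding tp by (simp add: field_simps)
  then show "rate2 \<sigma> (total_power \<sigma> r1 r2) (user1_power r1) = r2"
    by (simp add: rate2_def user1_power_def a_def b_def)
qed

definition slot_length :: "(nat \<Rightarrow> real) \<Rightarrow> nat \<Rightarrow> real" where
  "slot_length s n = s n - s (n - 1)"

definition weighted_throughput ::
    "nat \<Rightarrow> (nat \<Rightarrow> real) \<Rightarrow> real \<Rightarrow> real \<Rightarrow> (nat \<Rightarrow> real) \<Rightarrow> (nat \<Rightarrow> real) \<Rightarrow> real" where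
  "weighted_throughput N s \<mu>1 \<mu>2 r1 r2 =
     \<mu>1 * (\<Sum>n=1..N. r1 n * slot_length s n) + \<mu>2 * (\<Sum>n=1..N. r2 n * slot_length s n)"

definition feasible_policy ::
    "real \<Rightarrow> nat \<Rightarrow> (nat \<Rightarrow> real) \<Rightarrow> (nat \<Rightarrow> real) \<Rightarrow> (nat \<Rightarrow> real) \<Rightarrow> (nat \<Rightarrow> real) \<Rightarrow> bool" where
  "feasible_policy \<sigma> N s E r1 r2 \<longleftrightarrow>
     (\<forall>n\<in>{1..N}. 0 \<le> r1 n \<and> 0 \<le> r2 n) \<and>
     (\<forall>j\<in>{1..N}. (\<Sum>n=1..j. total_power \<sigma> (r1 n) (r2 n) * slot_length s n) \<le> (\<Sum>n<j. E n))"

definition optimal_policy ::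
    "real \<Rightarrow> nat \<Rightarrow> (nat \<Rightarrow> real) \<Rightarrow> (nat \<Rightarrow> real) \<Rightarrow> real \<Rightarrow> real
      \<Rightarrow> (nat \<Rightarrow> real) \<Rightarrow> (nat \<Rightarrow> real) \<Rightarrow> bool" where
  "optimal_policy \<sigma> N s E \<mu>1 \<mu>2 r1 r2 \<longleftrightarrow>
     feasible_policy \<sigma> N s E r1 r2 \<and>
     (\<forall>r1' r2'. feasible_policy \<sigma> N s E r1' r2' \<longrightarrow>
        weighted_throughput N s \<mu>1 \<mu>2 r1' r2' \<le> weighted_throughput N s \<mu>1 \<mu>2 r1 r2)"

text \<open>
  The closed form has a positive denominator only for \<open>\<mu>1 < \<mu>2\<close>.  For \<open>\<mu>1 \<ge> \<mu>2\<close> the cut-off is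
  infinite (the limit of the closed form as \<open>\<mu>2\<close> decreases to \<open>\<mu>1 > 0\<close>): the stronger user then
  receives all the power.  Evaluating the closed form literally for \<open>\<mu>1 > \<mu>2\<close> would give \<open>0\<close>,
  the opposite allocation.
\<close>

definition cutoff_power :: "real \<Rightarrow> real \<Rightarrow> real \<Rightarrow> ereal" where
  "cutoff_power \<sigma> \<mu>1 \<mu>2 =
     (if \<mu>1 < \<mu>2 then ereal (max (\<mu>1 * (\<sigma>\<^sup>2 - 1) / (\<mu>2 - \<mu>1) - 1) 0) else \<infinity>)"

end

theory Submission imports Defs begin

text \<open>
  Changing the power split inside one slot while keeping its total power \<open>P\<close> leaves every energy
  constraint unchanged, so an optimal policy maximises the weighted rate over the splits of each slot.
  With \<open>p\<close> the power of user 1, this weighted rate is, up to a positive factor and a term in \<open>P\<close> only,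
  \<open>\<mu>1 * ln (1 + p) - \<mu>2 * ln (p + \<sigma>\<^sup>2)\<close>.  Its derivative has the sign of
  \<open>\<mu>1 * (p + \<sigma>\<^sup>2) - \<mu>2 * (1 + p)\<close>, which is affine in \<open>p\<close> and changes sign at most once, from
  positive to negative, at the cut-off level.  Hence \<open>p = min P P\<^sub>c\<close> is the unique maximiser.
\<close>

definition split_gain :: "real \<Rightarrow> real \<Rightarrow> real \<Rightarrow> real \<Rightarrow> real" where
  "split_gain \<sigma> \<mu>1 \<mu>2 p = \<mu>1 * ln (1 + p) - \<mu>2 * ln (p + \<sigma>\<^sup>2)"

text \<open>The argument of the logarithm in \<open>rate2\<close> equals
  \<open>(P + \<sigma>\<^sup>2) / (p + \<sigma>\<^sup>2)\<close>, so the weighted rate separates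
  into a part in \<open>p\<close> and a part in \<open>P\<close>. As \<open>2 * ln 2\<close> is
  positive, splits of the same \<open>P\<close> can be compared by \<open>split_gain\<close>
  alone.\<close>

lemma weighted_rate_eq_split_gain:
  assumes "\<sigma>\<^sup>2 > 1" "0 \<le> p" "p \<le> P"
  shows "\<mu>1 * rate1 p + \<mu>2 * rate2 \<sigma> P p
    = (split_gain \<sigma> \<mu>1 \<mu>2 p + \<mu>2 * ln (P + \<sigma>\<^sup>2)) / (2 * ln 2)"
proof -
  have pos: "0 < p + \<sigma>\<^sup>2" "0 < P + \<sigma>\<^sup>2" using assms by linarith+
  have "1 + (P - p) / (p + \<sigma>\<^sup>2) = (P + \<sigma>\<^sup>2) / (p + \<sigma>\<^sup>2)"
    using pos by (simp add: field_simps)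
  then have "ln (1 + (P - p) / (p + \<sigma>\<^sup>2)) = ln (P + \<sigma>\<^sup>2) - ln (p + \<sigma>\<^sup>2)"
    using pos by (simp add: ln_div)
  then show ?thesis
    by (simp add: rate1_def rate2_def log_def split_gain_def diff_divide_distrib add_divide_distrib
        right_diff_distrib)
qed

lemma DERIV_split_gain:
  assumes "\<sigma>\<^sup>2 > 1" "0 \<le> p"
  shows "(split_gain \<sigma> \<mu>1 \<mu>2 has_real_derivative
    (\<mu>1 * (p + \<sigma>\<^sup>2) - \<mu>2 * (1 + p)) / ((1 + p) * (p + \<sigma>\<^sup>2))) (at p)"
proof -
  have pos: "0 < 1 + p" "0 < p + \<sigma>\<^sup>2" using assms by linarith+
  have "((\<lambda>p. \<mu>1 * ln (1 + p) - \<mu>2 * ln (p + \<sigma>\<^sup>2)) has_real_derivative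
      \<mu>1 * (1 / (1 + p)) - \<mu>2 * (1 / (p + \<sigma>\<^sup>2))) (at p)"
    using pos by (auto intro!: derivative_eq_intros)
  moreover have "\<mu>1 * (1 / (1 + p)) - \<mu>2 * (1 / (p + \<sigma>\<^sup>2))
      = (\<mu>1 * (p + \<sigma>\<^sup>2) - \<mu>2 * (1 + p)) / ((1 + p) * (p + \<sigma>\<^sup>2))"
    using pos by (simp add: diff_frac_eq)
  ultimately show ?thesis by (simp add: split_gain_def[abs_def])
qed

text \<open>The slope condition is asked only on the open interval, so that an endpoint may be the
  cut-off itself, where the derivative vanishes.\<close>

lemma split_gain_strict_increasing:
  assumes "\<sigma>\<^sup>2 > 1" "0 \<le> a" "a < b"
    and "\<And>x. a < x \<Longrightarrow> x < b \<Longrightarrow> \<mu>2 * (1 + x) < \<mu>1 * (x + \<sigma>\<^sup>2)"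
  shows "split_gain \<sigma> \<mu>1 \<mu>2 a < split_gain \<sigma> \<mu>1 \<mu>2 b"
proof (rule DERIV_pos_imp_increasing_open[OF \<open>a < b\<close>])
  fix x assume x: "a < x" "x < b"
  have "0 < (\<mu>1 * (x + \<sigma>\<^sup>2) - \<mu>2 * (1 + x)) / ((1 + x) * (x + \<sigma>\<^sup>2))"
    using assms x by (intro divide_pos_pos mult_pos_pos) auto
  then show "\<exists>y. (split_gain \<sigma> \<mu>1 \<mu>2 has_real_derivative y) (at x) \<and> 0 < y"
    using DERIV_split_gain[of \<sigma> x] assms x by force
next
  show "continuous_on {a..b} (split_gain \<sigma> \<mu>1 \<mu>2)"
    using assms by (intro continuous_at_imp_continuous_on ballI DERIV_isCont[OF DERIV_split_gain]) auto
qed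

text \<open>Negating both weights negates \<open>split_gain\<close> and reverses the slope
  condition, which reduces this to the increasing case.\<close>

lemma split_gain_strict_decreasing:
  assumes "\<sigma>\<^sup>2 > 1" "0 \<le> a" "a < b"
    and "\<And>x. a < x \<Longrightarrow> x < b \<Longrightarrow> \<mu>1 * (x + \<sigma>\<^sup>2) < \<mu>2 * (1 + x)"
  shows "split_gain \<sigma> \<mu>1 \<mu>2 b < split_gain \<sigma> \<mu>1 \<mu>2 a"
  using split_gain_strict_increasing[of \<sigma> a b "- \<mu>2" "- \<mu>1"] assms
  by (simp add: split_gain_def)

lemma split_gain_maximiser_at_cutoff:
  assumes "\<sigma>\<^sup>2 > 1" "\<mu>1 < \<mu>2" and C: "C = \<mu>1 * (\<sigma>\<^sup>2 - 1) / (\<mu>2 - \<mu>1) - 1"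
    and p: "0 \<le> p" "p \<le> P"
    and max: "\<And>q. 0 \<le> q \<Longrightarrow> q \<le> P \<Longrightarrow> split_gain \<sigma> \<mu>1 \<mu>2 q \<le> split_gain \<sigma> \<mu>1 \<mu>2 p"
  shows "p = min P (max C 0)"
proof (rule ccontr)
  define q where "q = min P (max C 0)"
  assume "p \<noteq> min P (max C 0)"
  then have "p \<noteq> q" by (simp add: q_def)
  have q: "0 \<le> q" "q \<le> P" using p by (auto simp: q_def)
  \<comment> \<open>\<open>C\<close> is the root of this affine function, whose leading coefficient
    \<open>\<mu>1 - \<mu>2\<close> is negative: the gain rises before \<open>C\<close> and falls
    after it. Moving from \<open>p\<close> towards \<open>q\<close> therefore strictly improves
    it.\<close>
  have slope: "\<mu>1 * (x + \<sigma>\<^sup>2) - \<mu>2 * (1 + x) = (\<mu>2 - \<mu>1) * (C - x)" for x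
  proof -
    have "(\<mu>2 - \<mu>1) * (C + 1) = \<mu>1 * (\<sigma>\<^sup>2 - 1)" using \<open>\<mu>1 < \<mu>2\<close> by (simp add: C)
    then show ?thesis by (simp add: algebra_simps)
  qed
  have "split_gain \<sigma> \<mu>1 \<mu>2 p < split_gain \<sigma> \<mu>1 \<mu>2 q"
  proof (cases "p < q")
    case True
    show ?thesis
    proof (rule split_gain_strict_increasing[OF \<open>\<sigma>\<^sup>2 > 1\<close> p(1) True])
      fix x assume "p < x" "x < q"
      \<comment> \<open>Here \<open>x\<close> is positive and below \<open>max C 0\<close>, so the
        maximum must be \<open>C\<close>.\<close>
      then have "x < C" using p by (auto simp: q_def)
      then have "0 < (\<mu>2 - \<mu>1) * (C - x)" using \<open>\<mu>1 < \<mu>2\<close> by simp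
      then show "\<mu>2 * (1 + x) < \<mu>1 * (x + \<sigma>\<^sup>2)" using slope[of x] by linarith
    qed
  next
    case False
    then have "q < p" using \<open>p \<noteq> q\<close> by simp
    show ?thesis
    proof (rule split_gain_strict_decreasing[OF \<open>\<sigma>\<^sup>2 > 1\<close> q(1) \<open>q < p\<close>])
      fix x assume "q < x" "x < p"
      \<comment> \<open>From \<open>q < x < p \<le> P\<close> the minimum in \<open>q\<close> is not
        \<open>P\<close>, so \<open>q = max C 0 \<ge> C\<close>.\<close>
      then have "C < x" using p by (auto simp: q_def min_def split: if_splits)
      then have "(\<mu>2 - \<mu>1) * (C - x) < 0" using \<open>\<mu>1 < \<mu>2\<close> by (simp add: mult_pos_neg)
      then show "\<mu>1 * (x + \<sigma>\<^sup>2) < \<mu>2 * (1 + x)" using slope[of x] by linarith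
    qed
  qed
  then show False using max[OF q] by simp
qed

text \<open>The slope is positive at every power level: \<open>1 + x < x + \<sigma>\<^sup>2\<close>,
  and \<open>0 < \<mu>1\<close> keeps the inequality strict even for equal weights.\<close>

lemma split_gain_maximiser_stronger_user:
  assumes "\<sigma>\<^sup>2 > 1" "0 < \<mu>1" "\<mu>2 \<le> \<mu>1"
    and p: "0 \<le> p" "p \<le> P"
    and max: "\<And>q. 0 \<le> q \<Longrightarrow> q \<le> P \<Longrightarrow> split_gain \<sigma> \<mu>1 \<mu>2 q \<le> split_gain \<sigma> \<mu>1 \<mu>2 p"
  shows "p = P"
proof (rule ccontr)
  assume "p \<noteq> P"
  then have "p < P" using p by simp
  have "split_gain \<sigma> \<mu>1 \<mu>2 p < split_gain \<sigma> \<mu>1 \<mu>2 P"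
  proof (rule split_gain_strict_increasing[OF \<open>\<sigma>\<^sup>2 > 1\<close> p(1) \<open>p < P\<close>])
    fix x assume "p < x"
    then have "\<mu>2 * (1 + x) \<le> \<mu>1 * (1 + x)" using assms by (intro mult_right_mono) auto
    also have "\<dots> < \<mu>1 * (x + \<sigma>\<^sup>2)" using assms by simp
    finally show "\<mu>2 * (1 + x) < \<mu>1 * (x + \<sigma>\<^sup>2)" .
  qed
  then show False using max[of P] p by simp
qed

text \<open>The total power factors as
  \<open>(a - 1 + \<sigma>\<^sup>2) * b - \<sigma>\<^sup>2\<close>, and \<open>b \<ge> 1\<close> for
  a nonnegative second rate. Nonnegative rates thus come from a genuine split of the total
  power.\<close>

lemma user1_power_bounds:
  assumes "\<sigma>\<^sup>2 > 1" "0 \<le> r1" "0 \<le> r2"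
  shows "0 \<le> user1_power r1" and "user1_power r1 \<le> total_power \<sigma> r1 r2"
proof -
  define a where "a = 2 powr (2 * r1)"
  define b where "b = 2 powr (2 * r2)"
  have ab: "1 \<le> a" "1 \<le> b" using assms by (auto simp: a_def b_def ge_one_powr_ge_zero)
  then show "0 \<le> user1_power r1" by (simp add: user1_power_def a_def)
  have "total_power \<sigma> r1 r2 = (a - 1 + \<sigma>\<^sup>2) * b - \<sigma>\<^sup>2"
    by (simp only: total_power_def distrib_left powr_add a_def b_def) (simp add: algebra_simps)
  moreover have "(a - 1 + \<sigma>\<^sup>2) * 1 \<le> (a - 1 + \<sigma>\<^sup>2) * b"
    using ab assms by (intro mult_left_mono) auto
  ultimately show "user1_power r1 \<le> total_power \<sigma> r1 r2"
    by (simp add: user1_power_def a_def)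
qed

lemma rate_nonneg:
  assumes "\<sigma>\<^sup>2 > 1" "0 \<le> p" "p \<le> P"
  shows "0 \<le> rate1 p" "0 \<le> rate2 \<sigma> P p"
proof -
  show "0 \<le> rate1 p" using assms by (simp add: rate1_def)
  have "0 \<le> (P - p) / (p + \<sigma>\<^sup>2)" using assms by (intro divide_nonneg_pos) auto
  then show "0 \<le> rate2 \<sigma> P p" by (simp add: rate2_def)
qed

lemma weighted_throughput_eq_sum:
  "weighted_throughput N s \<mu>1 \<mu>2 r1 r2 = (\<Sum>n=1..N. (\<mu>1 * r1 n + \<mu>2 * r2 n) * slot_length s n)"
  by (simp add: weighted_throughput_def sum_distrib_left sum.distrib algebra_simps)

text \<open>Exchanging the rates of one slot at equal total power preserves every cumulative energy
  sum. In the comparison of throughputs all other slots cancel, and the positive slot length can be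
  divided out.\<close>

lemma optimal_policy_slotwise:
  assumes "optimal_policy \<sigma> N s E \<mu>1 \<mu>2 r1 r2" "n \<in> {1..N}" "0 < slot_length s n"
    and "0 \<le> \<rho>1" "0 \<le> \<rho>2" "total_power \<sigma> \<rho>1 \<rho>2 = total_power \<sigma> (r1 n) (r2 n)"
  shows "\<mu>1 * \<rho>1 + \<mu>2 * \<rho>2 \<le> \<mu>1 * r1 n + \<mu>2 * r2 n"
proof -
  define r1' where "r1' = r1(n := \<rho>1)"
  define r2' where "r2' = r2(n := \<rho>2)"
  have "total_power \<sigma> (r1' k) (r2' k) = total_power \<sigma> (r1 k) (r2 k)" for k
    using assms by (simp add: r1'_def r2'_def)
  then have "feasible_policy \<sigma> N s E r1' r2'"
    using assms by (simp add: optimal_policy_def feasible_policy_def) (simp add: r1'_def r2'_def)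
  then have "weighted_throughput N s \<mu>1 \<mu>2 r1' r2' \<le> weighted_throughput N s \<mu>1 \<mu>2 r1 r2"
    using assms by (simp add: optimal_policy_def)
  moreover have "(\<Sum>k\<in>{1..N} - {n}. (\<mu>1 * r1' k + \<mu>2 * r2' k) * slot_length s k)
      = (\<Sum>k\<in>{1..N} - {n}. (\<mu>1 * r1 k + \<mu>2 * r2 k) * slot_length s k)"
    by (rule sum.cong) (auto simp: r1'_def r2'_def)
  ultimately have "(\<mu>1 * r1' n + \<mu>2 * r2' n) * slot_length s n
      \<le> (\<mu>1 * r1 n + \<mu>2 * r2 n) * slot_length s n"
    unfolding weighted_throughput_eq_sum
    by (simp only: sum.remove[OF finite_atLeastAtMost \<open>n \<in> {1..N}\<close>])
  then show ?thesis using assms(3) by (simp add: r1'_def r2'_def)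
qed

text \<open>Each \<open>q\<close> between \<open>0\<close> and the total power yields a rate pair
  with that same total power, hence a competitor for the slotwise comparison.\<close>

lemma optimal_policy_maximises_split_gain:
  assumes "\<sigma>\<^sup>2 > 1"
    and opt: "optimal_policy \<sigma> N s E \<mu>1 \<mu>2 r1 r2" "n \<in> {1..N}" "0 < slot_length s n"
    and q: "0 \<le> q" "q \<le> total_power \<sigma> (r1 n) (r2 n)"
  shows "split_gain \<sigma> \<mu>1 \<mu>2 q \<le> split_gain \<sigma> \<mu>1 \<mu>2 (user1_power (r1 n))"
proof -
  define P where "P = total_power \<sigma> (r1 n) (r2 n)"
  have "0 \<le> r1 n" "0 \<le> r2 n"
    using opt by (auto simp: optimal_policy_def feasible_policy_def)
  note p = user1_power_bounds[OF \<open>\<sigma>\<^sup>2 > 1\<close> this, folded P_def]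
  note q = q[folded P_def]
  have "\<mu>1 * rate1 q + \<mu>2 * rate2 \<sigma> P q \<le> \<mu>1 * r1 n + \<mu>2 * r2 n"
    using rate_nonneg[OF \<open>\<sigma>\<^sup>2 > 1\<close> q] powers_of_rates(2)[OF \<open>\<sigma>\<^sup>2 > 1\<close> q]
    by (intro optimal_policy_slotwise[OF opt]) (simp_all add: P_def)
  \<comment> \<open>The optimal rates are rewritten as the rates of their own power split, so that
    both sides can be expressed by \<open>split_gain\<close>.\<close>
  also have "\<dots> = \<mu>1 * rate1 (user1_power (r1 n)) + \<mu>2 * rate2 \<sigma> P (user1_power (r1 n))"
    using \<open>\<sigma>\<^sup>2 > 1\<close> by (simp add: P_def rates_of_powers)
  finally show ?thesis
    unfolding weighted_rate_eq_split_gain[OF \<open>\<sigma>\<^sup>2 > 1\<close> q]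
      weighted_rate_eq_split_gain[OF \<open>\<sigma>\<^sup>2 > 1\<close> p]
    by (simp add: divide_le_cancel)
qed

theorem lemma4:
  fixes N :: nat and T \<sigma> \<mu>1 \<mu>2 :: real
    and s E r1 r2 :: "nat \<Rightarrow> real"
  assumes "N \<ge> 1"
    and "s 0 = 0" and "\<forall>n<N. s n < s (Suc n)" and "s N = T"
    and "\<forall>k<N. 0 \<le> E k"
    and "\<sigma>\<^sup>2 > 1"
    and "0 \<le> \<mu>1" and "0 \<le> \<mu>2" and "\<not> (\<mu>1 = 0 \<and> \<mu>2 = 0)"
    and "optimal_policy \<sigma> N s E \<mu>1 \<mu>2 r1 r2"
  shows "\<exists>P\<^sub>c. P\<^sub>c = cutoff_power \<sigma> \<mu>1 \<mu>2 \<and>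
    (\<forall>n\<in>{1..N}.
      (ereal (total_power \<sigma> (r1 n) (r2 n)) < P\<^sub>c \<longrightarrow>
         user1_power (r1 n) = total_power \<sigma> (r1 n) (r2 n)) \<and>
      (P\<^sub>c < ereal (total_power \<sigma> (r1 n) (r2 n)) \<longrightarrow>
         ereal (user2_power \<sigma> (r1 n) (r2 n)) = ereal (total_power \<sigma> (r1 n) (r2 n)) - P\<^sub>c))"
proof (rule exI[of _ "cutoff_power \<sigma> \<mu>1 \<mu>2"], rule conjI[OF refl], rule ballI)
  fix n assume n: "n \<in> {1..N}"
  define P where "P = total_power \<sigma> (r1 n) (r2 n)"
  define p where "p = user1_power (r1 n)"
  \<comment> \<open>Since \<open>n \<ge> 1\<close>, the truncated subtraction in
    \<open>slot_length\<close> gives the true predecessor.\<close>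
  have "n - 1 < N" "Suc (n - 1) = n" using n by auto
  then have len: "0 < slot_length s n"
    using assms(3) by (metis slot_length_def diff_gt_0_iff_gt)
  have "0 \<le> r1 n" "0 \<le> r2 n"
    using assms(10) n by (auto simp: optimal_policy_def feasible_policy_def)
  note p = user1_power_bounds[OF \<open>\<sigma>\<^sup>2 > 1\<close> this, folded P_def p_def]
  note max = optimal_policy_maximises_split_gain[OF \<open>\<sigma>\<^sup>2 > 1\<close> assms(10) n len, folded P_def p_def]
  have "(ereal P < cutoff_power \<sigma> \<mu>1 \<mu>2 \<longrightarrow> p = P) \<and>
    (cutoff_power \<sigma> \<mu>1 \<mu>2 < ereal P \<longrightarrow> ereal (P - p) = ereal P - cutoff_power \<sigma> \<mu>1 \<mu>2)"
  proof (cases "\<mu>1 < \<mu>2")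
    case True
    define c where "c = max (\<mu>1 * (\<sigma>\<^sup>2 - 1) / (\<mu>2 - \<mu>1) - 1) 0"
    \<comment> \<open>This one equation gives both claims: \<open>p = P\<close> below the cut-off,
      and \<open>P - p = P - c\<close> above it.\<close>
    have "p = min P c" unfolding c_def
      by (rule split_gain_maximiser_at_cutoff[OF \<open>\<sigma>\<^sup>2 > 1\<close> True refl p max])
    moreover have "cutoff_power \<sigma> \<mu>1 \<mu>2 = ereal c"
      using True by (simp only: cutoff_power_def c_def if_True)
    ultimately show ?thesis by simp
  next
    case False
    \<comment> \<open>With \<open>\<mu>2 \<le> \<mu>1\<close>, weights that are nonnegative and not
      both zero force \<open>0 < \<mu>1\<close>. The cut-off is infinite here, so the second claim
      is vacuous.\<close>
    then have "p = P"
      using assms p max by (intro split_gain_maximiser_stronger_user[of \<sigma> \<mu>1 \<mu>2]) auto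
    with False show ?thesis by (simp add: cutoff_power_def)
  qed
  then show "(ereal (total_power \<sigma> (r1 n) (r2 n)) < cutoff_power \<sigma> \<mu>1 \<mu>2 \<longrightarrow>
         user1_power (r1 n) = total_power \<sigma> (r1 n) (r2 n)) \<and>
      (cutoff_power \<sigma> \<mu>1 \<mu>2 < ereal (total_power \<sigma> (r1 n) (r2 n)) \<longrightarrow>
         ereal (user2_power \<sigma> (r1 n) (r2 n)) =
           ereal (total_power \<sigma> (r1 n) (r2 n)) - cutoff_power \<sigma> \<mu>1 \<mu>2)"
    by (simp add: user2_power_def P_def p_def)
qed

end
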